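(* Let $p = p_1 + p_2$ with $p_1, p_2 \ge 1$, let $\boldsymbol{\mu}, \boldsymbol{c} \in \mathbb{R}^p$, and let $\boldsymbol{\Sigma}$ be a $p \times p$ (symmetric) positive definite matrix. Suppose that the random vector $\boldsymbol{W} \sim N_p(\boldsymbol{\mu},\boldsymbol{\Sigma},\boldsymbol{c})$, that is, $\boldsymbol{W}$ has the truncated multivariate normal distribution with parameters $\boldsymbol{\mu}$, $\boldsymbol{\Sigma}$ and truncation point $\boldsymbol{c}$. Decompose $\boldsymbol{W} = \begin{pmatrix}\boldsymbol{W}_1 \\ \boldsymbol{W}_2\end{pmatrix}$ with $\boldsymbol{W}_j$ of dimension $p_j$, $j=1,2$, and correspondingly $$\boldsymbol{\Sigma}=\begin{pmatrix}\boldsymbol{\Sigma}_{11} & \boldsymbol{\Sigma}_{12} \\ \boldsymbol{\Sigma}_{21} & \boldsymbol{\Sigma}_{22}\end{pmatrix},$$ where $\boldsymbol{\Sigma}_{jk}$ is of order $p_j \times p_k$ for $j,k=1,2$. Then $\boldsymbol{W}_1$ and $\boldsymbol{W}_2$ are mutually independent if and only if $\boldsymbol{\Sigma}_{12} = \boldsymbol{0}$.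
   Context: For column vectors $\boldsymbol{u}, \boldsymbol{v} \in \mathbb{R}^p$, write $\boldsymbol{u} \ge \boldsymbol{v}$ if $u_j \ge v_j$ for all $j = 1,\ldots,p$. For $\boldsymbol{\mu}, \boldsymbol{c} \in \mathbb{R}^p$ and a $p\times p$ positive definite matrix $\boldsymbol{\Sigma}$, a random vector $\boldsymbol{W} \in \mathbb{R}^p$ has the truncated multivariate normal distribution with truncation point $\boldsymbol{c}$, written $\boldsymbol{W} \sim N_p(\boldsymbol{\mu},\boldsymbol{\Sigma},\boldsymbol{c})$, if its probability density function is $$f(\boldsymbol{w};\boldsymbol{\mu},\boldsymbol{\Sigma},\boldsymbol{c}) = C \exp\left[-\tfrac12(\boldsymbol{w}-\boldsymbol{\mu})^{\top}\boldsymbol{\Sigma}^{-1}(\boldsymbol{w}-\boldsymbol{\mu})\right], \qquad \boldsymbol{w} \ge \boldsymbol{c},$$ (and zero elsewhere), where the normalizing constant $C$ is given by $C^{-1} = \int_{\boldsymbol{w} \ge \boldsymbol{c}} \exp\left[-\tfrac12(\boldsymbol{w}-\boldsymbol{\mu})^{\top}\boldsymbol{\Sigma}^{-1}(\boldsymbol{w}-\boldsymbol{\mu})\right] d\boldsymbol{w}$. Note that $\boldsymbol{\Sigma}$ is in general not the covariance matrix of $\boldsymbol{W}$. The symbol $\boldsymbol{0}$ denotes a zero matrix or vector of any dimension. *)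

theory Defs
  imports "HOL-Probability.Probability"
begin

text \<open>
  A vector of dimension p = p1 + p2 is indexed by the sum type \<open>'m + 'n\<close>, where
  p1 = \<open>CARD('m)\<close> and p2 = \<open>CARD('n)\<close>; \<open>Inl\<close> indexes the first p1 coordinates and \<open>Inr\<close>
  the last p2. The library order on vectors is the componentwise one, so \<open>{c..}\<close> is the set
  of all w with w \<open>\<ge>\<close> c.
\<close>

definition positive_definite :: "real^'k^'k \<Rightarrow> bool" where
  "positive_definite A \<longleftrightarrow> transpose A = A \<and> (\<forall>x. x \<noteq> 0 \<longrightarrow> 0 < x \<bullet> (A *v x))"

definition gauss_kernel :: "real^'k \<Rightarrow> real^'k^'k \<Rightarrow> real^'k \<Rightarrow> real" where
  "gauss_kernel \<mu> \<Sigma> w = exp (- (1/2) * ((w - \<mu>) \<bullet> (matrix_inv \<Sigma> *v (w - \<mu>))))"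

definition trunc_normal_density ::
    "real^'k \<Rightarrow> real^'k^'k \<Rightarrow> real^'k \<Rightarrow> real^'k \<Rightarrow> real" where
  "trunc_normal_density \<mu> \<Sigma> c w =
     (if c \<le> w then inverse (LINT v:{c..}|lborel. gauss_kernel \<mu> \<Sigma> v) * gauss_kernel \<mu> \<Sigma> w
      else 0)"

definition trunc_normal_distributed ::
    "'a measure \<Rightarrow> ('a \<Rightarrow> real^'k) \<Rightarrow> real^'k \<Rightarrow> real^'k^'k \<Rightarrow> real^'k \<Rightarrow> bool" where
  "trunc_normal_distributed M W \<mu> \<Sigma> c \<longleftrightarrow>
     distributed M lborel W (\<lambda>w. ennreal (trunc_normal_density \<mu> \<Sigma> c w))"

definition vec_part1 :: "real^('m::finite + 'n::finite) \<Rightarrow> real^'m" where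
  "vec_part1 v = (\<chi> i. v $ Inl i)"

definition vec_part2 :: "real^('m::finite + 'n::finite) \<Rightarrow> real^'n" where
  "vec_part2 v = (\<chi> j. v $ Inr j)"

text \<open>The upper right block, with p1 rows and p2 columns.\<close>

definition block12 :: "real^('m::finite + 'n::finite)^('m::finite + 'n::finite) \<Rightarrow> real^'n^'m" where
  "block12 A = (\<chi> i j. A $ Inl i $ Inr j)"

text \<open>
  The library constant \<open>prob_space.indep_var\<close> requires both random variables to take values in
  the same type. The following definition is the same condition for two value types; the lemma
  shows that the two notions agree where both apply.
\<close>

definition indep_rvs ::
    "'a measure \<Rightarrow> 'b measure \<Rightarrow> ('a \<Rightarrow> 'b) \<Rightarrow> 'c measure \<Rightarrow> ('a \<Rightarrow> 'c) \<Rightarrow> bool" where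
  "indep_rvs M S X T Y \<longleftrightarrow>
     X \<in> measurable M S \<and> Y \<in> measurable M T \<and>
     prob_space.indep_set M
       (sigma_sets (space M) {X -` A \<inter> space M | A. A \<in> sets S})
       (sigma_sets (space M) {Y -` B \<inter> space M | B. B \<in> sets T})"

lemma (in prob_space) indep_rvs_iff_indep_var: "indep_rvs M S X T Y \<longleftrightarrow> indep_var S X T Y"
  by (simp add: indep_rvs_def indep_var_eq conj_assoc)

end

theory Submission
  imports Defs
begin

text \<open>On \<open>w \<ge> c\<close> the density is a positive multiple of the Gaussian kernel, which splits into a
  function of \<open>w\<^sub>1\<close> times a function of \<open>w\<^sub>2\<close> when the off-diagonal block of the inverse of
  \<open>\<Sigma>\<close> vanishes; Fubini then gives independence. Conversely, independence forces
  \<open>f(c + u + v) f(c) = f(c + u) f(c + v)\<close> for unit vectors \<open>u\<close> of the first block and \<open>v\<close> of the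
  second, and the ratio of the two sides is the exponential of minus the corresponding entry of the
  inverse of \<open>\<Sigma>\<close>.\<close>

section \<open>Vectors split into two coordinate blocks\<close>

definition vec_join :: "real^'m::finite \<Rightarrow> real^'n::finite \<Rightarrow> real^('m + 'n)" where
  "vec_join x y = (\<chi> k. case k of Inl i \<Rightarrow> x $ i | Inr j \<Rightarrow> y $ j)"

lemma vec_join_Inl [simp]: "vec_join x y $ Inl i = x $ i"
  and vec_join_Inr [simp]: "vec_join x y $ Inr j = y $ j"
  by (simp_all add: vec_join_def)

lemma vec_part1_component [simp]: "vec_part1 v $ i = v $ Inl i"
  and vec_part2_component [simp]: "vec_part2 v $ j = v $ Inr j"
  by (simp_all add: vec_part1_def vec_part2_def)

lemma vec_part1_join [simp]: "vec_part1 (vec_join x y) = x"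
  and vec_part2_join [simp]: "vec_part2 (vec_join x y) = y"
  by (simp_all add: vec_eq_iff)

lemma all_sum_iff: "(\<forall>k. P k) \<longleftrightarrow> (\<forall>i. P (Inl i)) \<and> (\<forall>j. P (Inr j))"
  by (metis sumE)

lemma continuous_on_vec_part1: "continuous_on S vec_part1"
  and continuous_on_vec_part2: "continuous_on S vec_part2"
  unfolding vec_part1_def vec_part2_def by (intro continuous_intros)+

lemma borel_measurable_vec_parts [measurable]:
  "vec_part1 \<in> borel_measurable borel" "vec_part2 \<in> borel_measurable borel"
  by (intro borel_measurable_continuous_onI continuous_on_vec_part1 continuous_on_vec_part2)+

lemma continuous_on_vec_join:
  assumes "continuous_on S f" "continuous_on S g"
  shows "continuous_on S (\<lambda>x. vec_join (f x) (g x))"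
  unfolding vec_join_def
proof (rule continuous_on_vec_lambda)
  fix k
  show "continuous_on S (\<lambda>x. case k of Inl i \<Rightarrow> f x $ i | Inr j \<Rightarrow> g x $ j)"
    using assms by (cases k) (auto intro!: continuous_intros)
qed

lemma borel_measurable_vec_join [measurable]:
  "(\<lambda>(x, y). vec_join x y) \<in> borel_measurable (borel \<Otimes>\<^sub>M borel)"
  unfolding borel_prod case_prod_beta
  by (intro borel_measurable_continuous_onI continuous_on_vec_join continuous_intros)

section \<open>Lebesgue measure on joined vectors\<close>

lemma prod_UNIV_sum:
  "prod f (UNIV :: ('m::finite + 'n::finite) set) = (\<Prod>i\<in>UNIV. f (Inl i)) * (\<Prod>j\<in>UNIV. f (Inr j))"
  using prod.Plus[of UNIV UNIV f] by (simp add: comp_def)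

lemma sum_UNIV_sum:
  "sum f (UNIV :: ('m::finite + 'n::finite) set) = (\<Sum>i\<in>UNIV. f (Inl i)) + (\<Sum>j\<in>UNIV. f (Inr j))"
  using sum.Plus[of UNIV UNIV f] by (simp add: comp_def)

lemma prod_Basis_cart: "prod f (Basis :: (real^'k) set) = (\<Prod>i\<in>UNIV. f (axis i 1))"
  by (simp add: Basis_vec_def prod.UNION_disjoint axis_eq_axis)

lemma emeasure_lborel_box_cart:
  fixes l u :: "real^'k"
  assumes "\<And>i. l $ i \<le> u $ i"
  shows "emeasure lborel (box l u) = ennreal (\<Prod>i\<in>UNIV. u $ i - l $ i)"
proof -
  have "emeasure lborel (box l u) = ennreal (\<Prod>b\<in>Basis. (u - l) \<bullet> b)"
    using assms by (intro emeasure_lborel_box) (auto simp: Basis_vec_def inner_axis)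
  then show ?thesis
    by (simp add: prod_Basis_cart inner_axis)
qed

text \<open>Lebesgue measure is determined by its values on boxes. The preimage of a box under
  \<open>vec_join\<close> is a product of two boxes, so the pushforward gives the box the product of
  all its side lengths. This makes Tonelli available for vectors indexed by a sum type.\<close>

lemma lborel_vec_join:
  "distr (lborel \<Otimes>\<^sub>M lborel) borel (\<lambda>(x, y). vec_join x y) =
     (lborel :: (real^('m::finite + 'n::finite)) measure)"
proof (rule lborel_eqI[symmetric])
  fix l u :: "real^('m + 'n)"
  assume "\<And>b. b \<in> Basis \<Longrightarrow> l \<bullet> b \<le> u \<bullet> b"
  from this[of "axis k 1" for k] have le: "l $ k \<le> u $ k" for k
    by (auto simp: Basis_vec_def inner_axis)
  have vimage: "(\<lambda>(x, y). vec_join x y) -` box l u \<inter> space (lborel \<Otimes>\<^sub>M lborel) =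
      box (vec_part1 l) (vec_part1 u) \<times> box (vec_part2 l) (vec_part2 u)"
    by (auto simp: space_pair_measure mem_box_cart all_sum_iff)
  have "emeasure (distr (lborel \<Otimes>\<^sub>M lborel) borel (\<lambda>(x, y). vec_join x y)) (box l u) =
      emeasure lborel (box (vec_part1 l) (vec_part1 u)) *
      emeasure lborel (box (vec_part2 l) (vec_part2 u))"
    by (subst emeasure_distr) (simp_all add: vimage lborel.emeasure_pair_measure_Times)
  also have "\<dots> = ennreal (\<Prod>k\<in>UNIV. u $ k - l $ k)"
    using le by (simp add: emeasure_lborel_box_cart prod_UNIV_sum ennreal_mult prod_nonneg)
  also have "(\<Prod>k\<in>UNIV. u $ k - l $ k) = (\<Prod>b\<in>Basis. (u - l) \<bullet> b)"
    by (simp add: prod_Basis_cart inner_axis)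
  finally show "emeasure (distr (lborel \<Otimes>\<^sub>M lborel) borel (\<lambda>(x, y). vec_join x y)) (box l u) =
      ennreal (\<Prod>b\<in>Basis. (u - l) \<bullet> b)" .
qed simp

lemma nn_integral_lborel_parts_mult:
  fixes F :: "real^'m::finite \<Rightarrow> ennreal" and G :: "real^'n::finite \<Rightarrow> ennreal"
  assumes [measurable]: "F \<in> borel_measurable borel" "G \<in> borel_measurable borel"
  shows "(\<integral>\<^sup>+w. F (vec_part1 w) * G (vec_part2 w) \<partial>lborel) =
    (\<integral>\<^sup>+x. F x \<partial>lborel) * (\<integral>\<^sup>+y. G y \<partial>lborel)"
proof -
  have "(\<integral>\<^sup>+w. F (vec_part1 w) * G (vec_part2 w) \<partial>lborel) =
      (\<integral>\<^sup>+p. F (fst p) * G (snd p) \<partial>(lborel \<Otimes>\<^sub>M lborel))"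
    by (subst lborel_vec_join[symmetric], subst nn_integral_distr) (auto simp: case_prod_beta)
  also have "\<dots> = (\<integral>\<^sup>+x. \<integral>\<^sup>+y. F x * G y \<partial>lborel \<partial>lborel)"
    by (subst lborel.nn_integral_fst[symmetric]) simp_all
  also have "\<dots> = (\<integral>\<^sup>+x. F x \<partial>lborel) * (\<integral>\<^sup>+y. G y \<partial>lborel)"
    by (simp add: nn_integral_cmult nn_integral_multc)
  finally show ?thesis .
qed

section \<open>Point values recovered from averages over cubes\<close>

text \<open>Continuity keeps \<open>g\<close> within \<open>e / 2\<close> of \<open>g w\<close> on a
  small cube. Here \<open>1\<close> is the all-ones vector, and \<open>w\<close> is the lower corner
  rather than the centre, so that a cube attached to a boundary point of \<open>{c..}\<close> stays
  inside that set.\<close>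

lemma tendsto_integral_cube_average:
  fixes g :: "real^'k \<Rightarrow> real"
  assumes "continuous_on UNIV g"
  shows "((\<lambda>\<epsilon>. integral (cbox w (w + \<epsilon> *\<^sub>R 1)) g / \<epsilon> ^ CARD('k)) \<longlongrightarrow> g w) (at_right 0)"
proof (rule tendstoI)
  fix e :: real assume "e > 0"
  have "continuous (at w) g"
    using assms by (simp add: continuous_on_eq_continuous_at)
  then obtain d where d: "d > 0" "\<And>x. dist x w < d \<Longrightarrow> dist (g x) (g w) < e / 2"
    using \<open>e > 0\<close> unfolding continuous_at_eps_delta dist_norm by (metis half_gt_zero)
  \<comment> \<open>A cube of side \<epsilon> stays within \<epsilon> times \<open>norm 1\<close> of
    its corner; the extra summand 1 makes the denominator visibly positive.\<close>
  define r where "r = d / (1 + norm (1 :: real^'k))"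
  have "r > 0"
    using d(1) by (simp add: r_def add_pos_nonneg)
  have "dist (integral (cbox w (w + \<epsilon> *\<^sub>R 1)) g / \<epsilon> ^ CARD('k)) (g w) < e"
    if \<epsilon>: "0 < \<epsilon>" "\<epsilon> < r" for \<epsilon>
  proof -
    let ?C = "cbox w (w + \<epsilon> *\<^sub>R 1)"
    have vol: "measure lborel ?C = \<epsilon> ^ CARD('k)"
      using \<epsilon> by (subst content_cbox_cart) (auto simp: interval_eq_empty_cart not_less)
    have near: "dist x w < d" if "x \<in> ?C" for x
    proof -
      have "norm (x - w) \<le> norm (\<epsilon> *\<^sub>R (1 :: real^'k))"
      proof (rule norm_le_componentwise_cart)
        fix i
        have "w $ i \<le> x $ i" "x $ i \<le> w $ i + \<epsilon>"
          using that by (simp_all add: mem_box_cart)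
        then show "norm ((x - w) $ i) \<le> norm ((\<epsilon> *\<^sub>R (1 :: real^'k)) $ i)"
          using \<epsilon> by simp
      qed
      also have "\<dots> = \<epsilon> * norm (1 :: real^'k)"
        using \<epsilon> by simp
      also have "\<dots> \<le> \<epsilon> * (1 + norm (1 :: real^'k))"
        using \<epsilon> by simp
      also have "\<dots> < d"
        using \<epsilon> by (simp add: r_def pos_less_divide_eq add_pos_nonneg)
      finally show ?thesis by (simp add: dist_norm)
    qed
    have "g integrable_on ?C"
      using assms by (intro integrable_continuous) (rule continuous_on_subset, auto)
    then have "((\<lambda>x. g x - g w) has_integral (integral ?C g - measure lborel ?C *\<^sub>R g w)) ?C"
      by (intro has_integral_diff integrable_integral has_integral_const)
    then have "norm (integral ?C g - measure lborel ?C *\<^sub>R g w) \<le> e / 2 * measure lborel ?C"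
      by (rule has_integral_bound[rotated])
         (use near d(2) \<open>e > 0\<close> in \<open>auto simp: dist_norm less_imp_le\<close>)
    then have "\<bar>integral ?C g - \<epsilon> ^ CARD('k) * g w\<bar> \<le> e / 2 * \<epsilon> ^ CARD('k)"
      by (simp add: vol)
    then have "\<bar>integral ?C g - \<epsilon> ^ CARD('k) * g w\<bar> / \<bar>\<epsilon> ^ CARD('k)\<bar> \<le> e / 2"
      using \<epsilon> by (simp add: pos_divide_le_eq)
    then have "\<bar>integral ?C g / \<epsilon> ^ CARD('k) - g w\<bar> \<le> e / 2"
      using \<epsilon> unfolding abs_divide[symmetric] by (simp add: diff_divide_distrib)
    then show ?thesis
      using \<open>e > 0\<close> by (simp add: dist_real_def)
  qed
  then show "\<forall>\<^sub>F \<epsilon> in at_right 0. dist (integral (cbox w (w + \<epsilon> *\<^sub>R 1)) g / \<epsilon> ^ CARD('k)) (g w) < e"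
    using \<open>r > 0\<close> unfolding eventually_at_right_field by blast
qed

section \<open>Inverses of symmetric matrices and their blocks\<close>

lemma matrix_inv_eq:
  fixes A :: "real^'k^'k"
  assumes "invertible A"
  shows "A ** matrix_inv A = mat 1" "matrix_inv A ** A = mat 1"
proof -
  from assms have "\<exists>B. A ** B = mat 1 \<and> B ** A = mat 1"
    unfolding invertible_def .
  from someI_ex[OF this] show "A ** matrix_inv A = mat 1" "matrix_inv A ** A = mat 1"
    unfolding matrix_inv_def by simp_all
qed

text \<open>A kernel vector annihilates the quadratic form, so the kernel is trivial.\<close>

lemma positive_definite_invertible:
  assumes "positive_definite A"
  shows "invertible A"
proof -
  have "x = 0" if "A *v x = 0" for x
    using that assms unfolding positive_definite_def by force
  then show ?thesis
    unfolding invertible_left_inverse matrix_left_invertible_ker by blast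
qed

text \<open>Transposing \<open>A ** matrix_inv A = mat 1\<close> gives a left inverse of the
  symmetric matrix \<open>A\<close>, and a left inverse agrees with a right inverse.\<close>

lemma transpose_matrix_inv:
  fixes A :: "real^'k^'k"
  assumes "invertible A" "transpose A = A"
  shows "transpose (matrix_inv A) = matrix_inv A"
proof -
  have "transpose (matrix_inv A) ** A = mat 1"
    using arg_cong[OF matrix_inv_eq(1)[OF assms(1)], of transpose]
    by (simp add: matrix_transpose_mul transpose_mat assms(2))
  then have "(transpose (matrix_inv A) ** A) ** matrix_inv A = matrix_inv A"
    by simp
  then show ?thesis
    by (simp add: matrix_mul_assoc[symmetric] matrix_inv_eq(1)[OF assms(1)])
qed

text \<open>This is diag(I, -I). It expresses the vanishing of off-diagonal blocks as a commutation
  relation, which avoids block multiplication.\<close>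

definition block_sign :: "real^('m::finite + 'n::finite)^('m + 'n)" where
  "block_sign = (\<chi> k l. if k = l then case k of Inl _ \<Rightarrow> 1 | Inr _ \<Rightarrow> -1 else 0)"

text \<open>The two products multiply an entry by the sign of its column and of its row
  respectively. These signs differ only in the off-diagonal blocks, where equality forces the entry
  to be 0; by symmetry the upper right block decides for both.\<close>

lemma block_sign_commute_iff:
  fixes A :: "real^('m::finite + 'n::finite)^('m + 'n)"
  assumes "transpose A = A"
  shows "A ** block_sign = block_sign ** A \<longleftrightarrow> block12 A = 0"
proof -
  have sym: "A $ k $ l = A $ l $ k" for k l
    using arg_cong[OF assms, of "\<lambda>B. B $ l $ k"] by (simp add: Finite_Cartesian_Product.transpose_def)
  let ?s = "\<lambda>k :: 'm + 'n. case k of Inl _ \<Rightarrow> 1 | Inr _ \<Rightarrow> (-1 :: real)"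
  have right: "(A ** block_sign) $ k $ l = A $ k $ l * ?s l" for k l
    unfolding block_sign_def matrix_matrix_mult_def by (simp add: if_distrib[of "times _"] cong: if_cong)
  have left: "(block_sign ** A) $ k $ l = ?s k * A $ k $ l" for k l
    unfolding block_sign_def matrix_matrix_mult_def by (simp add: if_distrib[of "\<lambda>x. x * _"] cong: if_cong)
  have "A ** block_sign = block_sign ** A \<longleftrightarrow> (\<forall>k l. A $ k $ l * ?s l = ?s k * A $ k $ l)"
    by (simp add: vec_eq_iff left right)
  also have "\<dots> \<longleftrightarrow> (\<forall>i j. A $ Inl i $ Inr j = 0)"
    unfolding all_sum_iff by (simp add: sym[of "Inr _" "Inl _"] all_conj_distrib) blast
  finally show ?thesis
    by (simp add: block12_def vec_eq_iff)
qed

text \<open>A symmetric matrix is block diagonal iff it commutes with the sign matrix, and commutation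
  with a fixed matrix passes to the inverse.\<close>

lemma block12_matrix_inv_iff:
  fixes A :: "real^('m::finite + 'n::finite)^('m + 'n)"
  assumes "invertible A" "transpose A = A"
  shows "block12 (matrix_inv A) = 0 \<longleftrightarrow> block12 A = 0"
proof -
  \<comment> \<open>If \<open>D\<close> commutes with \<open>B\<close>, and \<open>C\<close> inverts
    \<open>B\<close>, then CD = CDBC = CBDC = DC.\<close>
  have comm: "C ** D = D ** C" if "B ** D = D ** B" "B ** C = mat 1" "C ** B = mat 1"
    for B C D :: "real^('m + 'n)^('m + 'n)"
  proof -
    have "C ** D = C ** (D ** B) ** C"
      by (simp only: matrix_mul_assoc[symmetric] that(2) matrix_mul_rid)
    also have "\<dots> = D ** C"
      by (simp only: that(1)[symmetric] matrix_mul_assoc that(3) matrix_mul_lid)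
    finally show ?thesis .
  qed
  show ?thesis
    unfolding block_sign_commute_iff[OF assms(2), symmetric]
      block_sign_commute_iff[OF transpose_matrix_inv[OF assms], symmetric]
    using comm[OF _ matrix_inv_eq[OF assms(1)]] comm[OF _ matrix_inv_eq(2,1)[OF assms(1)]]
    by blast
qed

section \<open>Independence as a product formula\<close>

text \<open>Preimages commute with complements and countable unions, so the family is already a
  sigma-algebra. This removes \<open>sigma_sets\<close> from the definition of independence.\<close>

lemma sigma_sets_vimage_eq:
  assumes "X \<in> M \<rightarrow>\<^sub>M N"
  shows "sigma_sets (space M) {X -` A \<inter> space M | A. A \<in> sets N} =
    {X -` A \<inter> space M | A. A \<in> sets N}"
  using sets_vimage_algebra2[of X "space M" N] assms
  by (simp add: sets_vimage_algebra measurable_def)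

lemma (in prob_space) indep_rvs_iff:
  assumes "X \<in> M \<rightarrow>\<^sub>M S" "Y \<in> M \<rightarrow>\<^sub>M T"
  shows "indep_rvs M S X T Y \<longleftrightarrow>
    (\<forall>A\<in>sets S. \<forall>B\<in>sets T. prob ((X -` A \<inter> space M) \<inter> (Y -` B \<inter> space M)) =
       prob (X -` A \<inter> space M) * prob (Y -` B \<inter> space M))"
  using assms measurable_sets[OF assms(1)] measurable_sets[OF assms(2)]
  unfolding indep_rvs_def indep_sets2_eq sigma_sets_vimage_eq[OF assms(1)]
    sigma_sets_vimage_eq[OF assms(2)]
  by blast

section \<open>The Gaussian kernel\<close>

lemma continuous_on_gauss_kernel: "continuous_on S (gauss_kernel \<mu> A)"
proof -
  have "continuous_on S (\<lambda>w. matrix_inv A *v (w - \<mu>))"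
    by (rule continuous_on_compose2[OF matrix_vector_mult_linear_continuous_on[of UNIV]])
       (auto intro!: continuous_intros)
  then show ?thesis
    unfolding gauss_kernel_def[abs_def] by (intro continuous_intros)
qed

lemma borel_measurable_gauss_kernel [measurable]: "gauss_kernel \<mu> A \<in> borel_measurable borel"
  by (intro borel_measurable_continuous_onI continuous_on_gauss_kernel)

lemma gauss_kernel_pos: "0 < gauss_kernel \<mu> A w"
  by (simp add: gauss_kernel_def)

lemma closed_Ici_cart: "closed {c :: real^'k ..}"
proof -
  have "{c..} = (\<Inter>i. {w. c $ i \<le> w $ i})"
    by (auto simp: less_eq_vec_def)
  then show ?thesis
    by (auto intro!: closed_INT closed_Collect_le continuous_intros)
qed

lemma borel_Ici_cart [measurable]: "{c :: real^'k ..} \<in> sets borel"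
  by (rule borel_closed[OF closed_Ici_cart])

text \<open>In the second mixed difference of the quadratic form only the cross terms of
  \<open>u\<close> and \<open>v\<close> survive. They coincide because the inverse is symmetric, and
  the factor 1/2 in the exponent cancels the doubling.\<close>

lemma gauss_kernel_add:
  fixes A :: "real^'k^'k"
  assumes "invertible A" "transpose A = A"
  shows "gauss_kernel \<mu> A (w + u + v) * gauss_kernel \<mu> A w =
    gauss_kernel \<mu> A (w + u) * gauss_kernel \<mu> A (w + v) * exp (- (u \<bullet> (matrix_inv A *v v)))"
proof -
  let ?B = "matrix_inv A"
  have sym: "x \<bullet> (?B *v y) = y \<bullet> (?B *v x)" for x y
    by (metis transpose_matrix_inv[OF assms] dot_lmul_matrix inner_commute transpose_matrix_vector)
  define d where "d = w - \<mu>"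
  have shift: "w - \<mu> = d" "w + u - \<mu> = d + u" "w + v - \<mu> = d + v" "w + u + v - \<mu> = d + u + v"
    by (simp_all add: d_def)
  show ?thesis
    unfolding gauss_kernel_def exp_add[symmetric] shift
    by (simp add: matrix_vector_right_distrib inner_add_left inner_add_right
        sym[of u d] sym[of v d] sym[of v u] field_simps)
qed

lemma block12_zero_inner:
  fixes B :: "real^('m::finite + 'n::finite)^('m + 'n)"
  assumes "block12 B = 0"
  shows "vec_join x 0 \<bullet> (B *v vec_join 0 y) = 0"
proof -
  have "B $ Inl i $ Inr j = 0" for i j
    using assms by (simp add: block12_def vec_eq_iff)
  then show ?thesis
    by (simp add: inner_vec_def matrix_vector_mult_def sum_UNIV_sum)
qed

text \<open>This is \<open>gauss_kernel_add\<close> at the base point \<mu>, where the kernel is 1,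
  with the two blocks of \<open>w - \<mu>\<close> as increments; their cross term vanishes.\<close>

lemma gauss_kernel_factor:
  fixes A :: "real^('m::finite + 'n::finite)^('m + 'n)"
  assumes "invertible A" "transpose A = A" "block12 A = 0"
  shows "gauss_kernel \<mu> A w =
    gauss_kernel \<mu> A (vec_join (vec_part1 w) (vec_part2 \<mu>)) *
    gauss_kernel \<mu> A (vec_join (vec_part1 \<mu>) (vec_part2 w))"
proof -
  let ?u = "vec_join (vec_part1 (w - \<mu>)) 0" and ?v = "vec_join 0 (vec_part2 (w - \<mu>))"
  have parts: "vec_join (vec_part1 w) (vec_part2 \<mu>) + ?v = w" "\<mu> + ?u = vec_join (vec_part1 w) (vec_part2 \<mu>)"
    "\<mu> + ?v = vec_join (vec_part1 \<mu>) (vec_part2 w)"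
    by (simp_all add: vec_eq_iff all_sum_iff)
  have "?u \<bullet> (matrix_inv A *v ?v) = 0"
    using assms by (intro block12_zero_inner) (simp add: block12_matrix_inv_iff)
  moreover have "gauss_kernel \<mu> A \<mu> = 1"
    by (simp add: gauss_kernel_def)
  ultimately show ?thesis
    using gauss_kernel_add[OF assms(1,2), of \<mu> \<mu> ?u ?v] unfolding parts by simp
qed

section \<open>Normalizing constant and probabilities of the truncated law\<close>

definition trunc_normal_const :: "real^'k \<Rightarrow> real^'k^'k \<Rightarrow> real^'k \<Rightarrow> real" where
  "trunc_normal_const \<mu> A c = inverse (LINT v:{c..}|lborel. gauss_kernel \<mu> A v)"

lemma trunc_normal_density_eq:
  "trunc_normal_density \<mu> A c w = trunc_normal_const \<mu> A c * gauss_kernel \<mu> A w * indicator {c..} w"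
  by (simp add: trunc_normal_density_def trunc_normal_const_def)

lemma trunc_normal_const_nonneg: "0 \<le> trunc_normal_const \<mu> A c"
  unfolding trunc_normal_const_def set_lebesgue_integral_def
  by (auto intro!: integral_nonneg_AE simp: gauss_kernel_pos less_imp_le)

text \<open>The inverse of 0 and the integral of a non-integrable function are both 0 by convention,
  so the constant might be 0. Then the density would vanish everywhere, contradicting total mass
  1.\<close>

lemma (in prob_space) trunc_normal_const_pos:
  assumes "trunc_normal_distributed M W \<mu> A c"
  shows "0 < trunc_normal_const \<mu> A c"
proof (rule ccontr)
  assume "\<not> 0 < trunc_normal_const \<mu> A c"
  then have "trunc_normal_const \<mu> A c = 0"
    using trunc_normal_const_nonneg[of \<mu> A c] by simp
  then have "emeasure M (W -` UNIV \<inter> space M) = 0"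
    using assms unfolding trunc_normal_distributed_def
    by (subst distributed_emeasure[of M lborel W]) (auto simp: trunc_normal_density_eq)
  then show False
    by (simp add: emeasure_space_1)
qed

text \<open>On a compact set the continuous kernel is integrable whatever \<open>A\<close> is, and
  inside \<open>{c..}\<close> the truncation is invisible.\<close>

lemma (in prob_space) trunc_normal_prob_compact:
  assumes "trunc_normal_distributed M W \<mu> A c" "compact C" "C \<subseteq> {c..}"
  shows "prob (W -` C \<inter> space M) = trunc_normal_const \<mu> A c * integral C (gauss_kernel \<mu> A)"
proof -
  let ?K = "trunc_normal_const \<mu> A c" and ?g = "gauss_kernel \<mu> A"
  have [measurable]: "C \<in> sets borel"
    using assms(2) by (simp add: borel_compact)
  have int: "set_integrable lborel C ?g"
    unfolding set_integrable_def
    by (intro borel_integrable_compact assms continuous_on_gauss_kernel)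
  have "emeasure M (W -` C \<inter> space M) =
      (\<integral>\<^sup>+w. ennreal (trunc_normal_density \<mu> A c w) * indicator C w \<partial>lborel)"
    using assms(1) unfolding trunc_normal_distributed_def by (rule distributed_emeasure) simp
  also have "\<dots> = (\<integral>\<^sup>+w. ennreal (?K * (indicator C w *\<^sub>R ?g w)) \<partial>lborel)"
    using assms(3) by (intro nn_integral_cong) (auto simp: trunc_normal_density_eq split: split_indicator)
  also have "\<dots> = ennreal (LINT w|lborel. ?K * (indicator C w *\<^sub>R ?g w))"
    using int trunc_normal_const_nonneg[of \<mu> A c] unfolding set_integrable_def
    by (intro nn_integral_eq_integral) (auto simp: gauss_kernel_pos less_imp_le)
  also have "(LINT w|lborel. ?K * (indicator C w *\<^sub>R ?g w)) = ?K * (LINT w:C|lborel. ?g w)"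
    by (simp add: set_lebesgue_integral_def)
  also have "(LINT w:C|lborel. ?g w) = integral C ?g"
    by (rule set_borel_integral_eq_integral(2)[OF int])
  finally show ?thesis
    using trunc_normal_const_nonneg[of \<mu> A c] integral_nonneg[OF set_borel_integral_eq_integral(1)[OF int]]
    by (simp add: measure_def gauss_kernel_pos less_imp_le)
qed

section \<open>Independence forces the off-diagonal block to vanish\<close>

lemma cbox_vec_parts:
  "w \<in> cbox l u \<longleftrightarrow> vec_part1 w \<in> cbox (vec_part1 l) (vec_part1 u) \<and>
     vec_part2 w \<in> cbox (vec_part2 l) (vec_part2 u)"
  by (simp add: mem_box_cart all_sum_iff)

text \<open>Independence gives \<open>P(A \<times> B) P(A' \<times> B') = P(A \<times> B') P(A' \<times> B)\<close>; applied to small cubes with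
  corners \<open>c + u + v\<close>, \<open>c\<close>, \<open>c + u\<close>, \<open>c + v\<close>, it becomes the same identity for the density.\<close>

lemma (in prob_space) trunc_normal_indep_imp_block12_zero:
  fixes W :: "'a \<Rightarrow> real^('m::finite + 'n::finite)"
  assumes A: "invertible A" "transpose A = A"
    and W: "trunc_normal_distributed M W \<mu> A c"
    and indep: "\<And>S T. S \<in> sets borel \<Longrightarrow> T \<in> sets borel \<Longrightarrow>
      prob ((\<lambda>\<omega>. vec_part1 (W \<omega>)) -` S \<inter> space M \<inter> ((\<lambda>\<omega>. vec_part2 (W \<omega>)) -` T \<inter> space M)) =
      prob ((\<lambda>\<omega>. vec_part1 (W \<omega>)) -` S \<inter> space M) * prob ((\<lambda>\<omega>. vec_part2 (W \<omega>)) -` T \<inter> space M)"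
  shows "block12 A = 0"
proof -
  let ?g = "gauss_kernel \<mu> A"
  define avg where "avg w \<epsilon> = integral (cbox w (w + \<epsilon> *\<^sub>R 1)) ?g / \<epsilon> ^ CARD('m + 'n)" for w \<epsilon>
  define p1 where "p1 S = prob ((\<lambda>\<omega>. vec_part1 (W \<omega>)) -` S \<inter> space M)" for S
  define p2 where "p2 T = prob ((\<lambda>\<omega>. vec_part2 (W \<omega>)) -` T \<inter> space M)" for T
  have avg_lim: "(avg w \<longlongrightarrow> ?g w) (at_right 0)" for w
    unfolding avg_def[abs_def] by (rule tendsto_integral_cube_average[OF continuous_on_gauss_kernel])
  have avg_eq: "trunc_normal_const \<mu> A c * \<epsilon> ^ CARD('m + 'n) * avg w \<epsilon> =
      p1 (cbox (vec_part1 w) (vec_part1 w + \<epsilon> *\<^sub>R 1)) * p2 (cbox (vec_part2 w) (vec_part2 w + \<epsilon> *\<^sub>R 1))"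
    if "c \<le> w" "0 < \<epsilon>" for w \<epsilon>
  proof -
    have parts: "vec_part1 (w + \<epsilon> *\<^sub>R 1) = vec_part1 w + \<epsilon> *\<^sub>R 1"
      "vec_part2 (w + \<epsilon> *\<^sub>R 1) = vec_part2 w + \<epsilon> *\<^sub>R 1"
      by (simp_all add: vec_eq_iff)
    have "W -` cbox w (w + \<epsilon> *\<^sub>R 1) \<inter> space M =
        (\<lambda>\<omega>. vec_part1 (W \<omega>)) -` cbox (vec_part1 w) (vec_part1 w + \<epsilon> *\<^sub>R 1) \<inter> space M \<inter>
        ((\<lambda>\<omega>. vec_part2 (W \<omega>)) -` cbox (vec_part2 w) (vec_part2 w + \<epsilon> *\<^sub>R 1) \<inter> space M)"
      by (auto simp: cbox_vec_parts parts)
    \<comment> \<open>The cube extends upwards from its lower corner, so even the corner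
      \<open>c\<close> itself is admissible.\<close>
    moreover have "cbox w (w + \<epsilon> *\<^sub>R 1) \<subseteq> {c..}"
      using that(1) by (auto simp: less_eq_vec_def mem_box_cart) (meson order_trans)
    ultimately show ?thesis
      using trunc_normal_prob_compact[OF W compact_cbox, of w "w + \<epsilon> *\<^sub>R 1"] that(2)
      by (simp add: avg_def p1_def p2_def indep)
  qed
  have "matrix_inv A $ Inl i $ Inr j = 0" for i j
  proof -
    define u v :: "real^('m + 'n)" where "u = axis (Inl i) 1" and "v = axis (Inr j) 1"
    have ge: "c \<le> c" "c \<le> c + u" "c \<le> c + v" "c \<le> c + u + v"
      by (simp_all add: less_eq_vec_def u_def v_def axis_def)
    have parts: "vec_part1 v = 0" "vec_part2 u = 0"
        "vec_part1 (c + u + v) = vec_part1 (c + u)" "vec_part2 (c + u + v) = vec_part2 (c + v)"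
        "vec_part1 (c + v) = vec_part1 c" "vec_part2 (c + u) = vec_part2 c"
      by (simp_all add: vec_eq_iff u_def v_def axis_def)
    have eq: "avg (c + u + v) \<epsilon> * avg c \<epsilon> = avg (c + u) \<epsilon> * avg (c + v) \<epsilon>" if "0 < \<epsilon>" for \<epsilon>
    proof -
      let ?k = "trunc_normal_const \<mu> A c * \<epsilon> ^ CARD('m + 'n)"
      \<comment> \<open>The four cubes involve only two cubes in each block, so both sides are the
        same four marginal probabilities in a different order.\<close>
      have "(?k * avg (c + u + v) \<epsilon>) * (?k * avg c \<epsilon>) = (?k * avg (c + u) \<epsilon>) * (?k * avg (c + v) \<epsilon>)"
        unfolding avg_eq[OF ge(1) that] avg_eq[OF ge(2) that] avg_eq[OF ge(3) that]
          avg_eq[OF ge(4) that] parts by (simp only: mult_ac)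
      moreover have "?k \<noteq> 0"
        using trunc_normal_const_pos[OF W] that by simp
      ultimately show ?thesis by simp
    qed
    have "((\<lambda>\<epsilon>. avg (c + u + v) \<epsilon> * avg c \<epsilon>) \<longlongrightarrow> ?g (c + u) * ?g (c + v)) (at_right 0)"
      by (rule Lim_transform_eventually[OF tendsto_mult[OF avg_lim avg_lim]])
         (auto simp: eventually_at_right_field eq intro!: exI[of _ 1])
    then have "?g (c + u + v) * ?g c = ?g (c + u) * ?g (c + v)"
      by (rule tendsto_unique[OF _ tendsto_mult[OF avg_lim avg_lim], rotated]) simp
    \<comment> \<open>Cancelling the positive kernel values leaves exp of minus the cross term equal
      to 1.\<close>
    then have "u \<bullet> (matrix_inv A *v v) = 0"
      using gauss_kernel_pos[of \<mu> A "c + u"] gauss_kernel_pos[of \<mu> A "c + v"]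
      unfolding gauss_kernel_add[OF A] by (auto simp: less_le)
    \<comment> \<open>For these unit vectors the bilinear form is the entry in question.\<close>
    then show ?thesis
      by (simp add: u_def v_def inner_axis' matrix_vector_mul_component inner_axis)
  qed
  then have "block12 (matrix_inv A) = 0"
    by (simp add: block12_def vec_eq_iff)
  then show ?thesis
    using block12_matrix_inv_iff[OF A] by simp
qed

section \<open>A vanishing off-diagonal block gives independence\<close>

text \<open>Kernel and truncation set both split along the blocks, so every joint probability is a
  product \<open>a S * b T\<close>.\<close>

lemma (in prob_space) trunc_normal_block12_zero_imp_indep:
  fixes W :: "'a \<Rightarrow> real^('m::finite + 'n::finite)"
  assumes A: "invertible A" "transpose A = A" "block12 A = 0"
    and W: "trunc_normal_distributed M W \<mu> A c"
    and S: "S \<in> sets borel" and T: "T \<in> sets borel"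
  shows "prob ((\<lambda>\<omega>. vec_part1 (W \<omega>)) -` S \<inter> space M \<inter> ((\<lambda>\<omega>. vec_part2 (W \<omega>)) -` T \<inter> space M)) =
    prob ((\<lambda>\<omega>. vec_part1 (W \<omega>)) -` S \<inter> space M) * prob ((\<lambda>\<omega>. vec_part2 (W \<omega>)) -` T \<inter> space M)"
proof -
  note [measurable] = S T
  \<comment> \<open>The normalizing constant goes entirely into \<open>F\<close>; neither factor
    need be a probability density by itself.\<close>
  define F where "F x = ennreal (trunc_normal_const \<mu> A c) *
    (ennreal (gauss_kernel \<mu> A (vec_join x (vec_part2 \<mu>))) * indicator {vec_part1 c..} x)" for x
  define G where "G y = ennreal (gauss_kernel \<mu> A (vec_join (vec_part1 \<mu>) y)) *
    indicator {vec_part2 c..} y" for y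
  have [measurable]: "(\<lambda>x. gauss_kernel \<mu> A (vec_join x (vec_part2 \<mu>))) \<in> borel_measurable borel"
    "(\<lambda>y. gauss_kernel \<mu> A (vec_join (vec_part1 \<mu>) y)) \<in> borel_measurable borel"
    by (intro borel_measurable_continuous_onI
        continuous_on_compose2[OF continuous_on_gauss_kernel[of UNIV]]
        continuous_on_vec_join continuous_intros subset_UNIV)+
  have [measurable]: "F \<in> borel_measurable borel" "G \<in> borel_measurable borel"
    unfolding F_def[abs_def] G_def[abs_def] by measurable
  have density: "ennreal (trunc_normal_density \<mu> A c w) = F (vec_part1 w) * G (vec_part2 w)" for w
  proof -
    have "(indicator {c..} w :: real) =
        indicator {vec_part1 c..} (vec_part1 w) * indicator {vec_part2 c..} (vec_part2 w)"
      by (auto simp: less_eq_vec_def all_sum_iff split: split_indicator)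
    then show ?thesis
      using trunc_normal_const_nonneg[of \<mu> A c]
      unfolding trunc_normal_density_eq gauss_kernel_factor[OF A, of \<mu> w] F_def G_def
      by (simp add: ennreal_mult gauss_kernel_pos less_imp_le ennreal_indicator mult_ac)
  qed
  define a where "a S = (\<integral>\<^sup>+x. F x * indicator S x \<partial>lborel)" for S
  define b where "b T = (\<integral>\<^sup>+y. G y * indicator T y \<partial>lborel)" for T
  have em: "emeasure M ((\<lambda>\<omega>. vec_part1 (W \<omega>)) -` S \<inter> space M \<inter> ((\<lambda>\<omega>. vec_part2 (W \<omega>)) -` T \<inter> space M)) =
      a S * b T" if [measurable]: "S \<in> sets borel" "T \<in> sets borel" for S T
  proof -
    let ?R = "vec_part1 -` S \<inter> vec_part2 -` T :: (real^('m + 'n)) set"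
    have [measurable]: "?R \<in> sets borel"
      using measurable_sets[OF borel_measurable_vec_parts(1) that(1)]
        measurable_sets[OF borel_measurable_vec_parts(2) that(2)] by simp
    have "(\<lambda>\<omega>. vec_part1 (W \<omega>)) -` S \<inter> space M \<inter> ((\<lambda>\<omega>. vec_part2 (W \<omega>)) -` T \<inter> space M) =
        W -` ?R \<inter> space M"
      by auto
    also have "emeasure M (W -` ?R \<inter> space M) =
        (\<integral>\<^sup>+w. ennreal (trunc_normal_density \<mu> A c w) * indicator ?R w \<partial>lborel)"
      using W unfolding trunc_normal_distributed_def by (rule distributed_emeasure) simp
    also have "\<dots> = (\<integral>\<^sup>+w. (F (vec_part1 w) * indicator S (vec_part1 w)) *
        (G (vec_part2 w) * indicator T (vec_part2 w)) \<partial>lborel)"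
      by (intro nn_integral_cong) (auto simp: density split: split_indicator)
    also have "\<dots> = a S * b T"
      unfolding a_def b_def by (intro nn_integral_lborel_parts_mult) measurable
    finally show ?thesis .
  qed
  \<comment> \<open>Only the product of the two masses is known to be 1. That suffices, since the
    marginals \<open>a S * b UNIV\<close> and \<open>a UNIV * b T\<close> multiply to this total
    times the joint probability.\<close>
  have total: "a UNIV * b UNIV = 1"
    using em[of UNIV UNIV] by (simp add: emeasure_space_1)
  have "emeasure M ((\<lambda>\<omega>. vec_part1 (W \<omega>)) -` S \<inter> space M) *
      emeasure M ((\<lambda>\<omega>. vec_part2 (W \<omega>)) -` T \<inter> space M) = (a S * b UNIV) * (a UNIV * b T)"
    using em[of S UNIV] em[of UNIV T] S T by (simp add: Int_absorb1 Int_absorb2)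
  also have "\<dots> = (a UNIV * b UNIV) * (a S * b T)"
    by (simp only: mult_ac)
  also have "\<dots> = emeasure M ((\<lambda>\<omega>. vec_part1 (W \<omega>)) -` S \<inter> space M \<inter>
      ((\<lambda>\<omega>. vec_part2 (W \<omega>)) -` T \<inter> space M))"
    by (simp add: total em)
  finally show ?thesis
    by (simp add: emeasure_eq_measure ennreal_mult'[symmetric])
qed

theorem theorem3p1:
  fixes M :: "'a measure"
    and W :: "'a \<Rightarrow> real^('m::finite + 'n::finite)"
    and \<mu> c :: "real^('m + 'n)"
    and \<Sigma> :: "real^('m + 'n)^('m + 'n)"
  assumes "prob_space M"
    and "positive_definite \<Sigma>"
    and "trunc_normal_distributed M W \<mu> \<Sigma> c"
  shows "indep_rvs M borel (\<lambda>\<omega>. vec_part1 (W \<omega>)) borel (\<lambda>\<omega>. vec_part2 (W \<omega>))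
         \<longleftrightarrow> block12 \<Sigma> = 0"
proof -
  interpret prob_space M by fact
  have \<Sigma>: "invertible \<Sigma>" "transpose \<Sigma> = \<Sigma>"
    using assms(2) by (simp_all add: positive_definite_invertible) (simp add: positive_definite_def)
  have [measurable]: "W \<in> borel_measurable M"
    using distributed_measurable[OF assms(3)[unfolded trunc_normal_distributed_def]] by simp
  have "(\<lambda>\<omega>. vec_part1 (W \<omega>)) \<in> borel_measurable M" "(\<lambda>\<omega>. vec_part2 (W \<omega>)) \<in> borel_measurable M"
    by measurable
  then show ?thesis
    using trunc_normal_indep_imp_block12_zero[OF \<Sigma> assms(3)]
      trunc_normal_block12_zero_imp_indep[OF \<Sigma> _ assms(3)]
    by (subst indep_rvs_iff) blast+
qed

end
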